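(* Let $\Omega\subset\mathbb{C}^n$ be a domain and let $1<p<2$. Suppose there exists a bounded linear operator $\mathbf{P}:L^2(\Omega)\to A^2(\Omega)$ given by an integral formula $\mathbf{P}f(z)=\int_\Omega P(z,w)f(w)\,dV(w)$ such that (1) there is $C>0$ with $\|\mathbf{P}f\|_p\le C\|f\|_p$ for all $f\in L^p(\Omega)$; (2) $\mathbf{P}h=h$ for all $h\in A^p(\Omega)$. Then every $f\in A^p(\Omega)$ can be approximated in the $L^p$ norm by a sequence $f_n\in A^2(\Omega)$.
   Context: $dV$ is Lebesgue measure; $A^p(\Omega)$ is the Bergman space of holomorphic functions on $\Omega$ lying in $L^p(\Omega)$, with the $L^p$ norm $\|\cdot\|_p$. On $L^p(\Omega)$ the operator $\mathbf{P}$ is defined by the same integral formula. *)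

theory Defs
  imports "HOL-Analysis.Analysis"
begin

definition domain_in :: "(complex ^ 'n) set \<Rightarrow> bool" where
  "domain_in \<Omega> \<longleftrightarrow> open \<Omega> \<and> connected \<Omega> \<and> \<Omega> \<noteq> {}"

definition holomorphic_several :: "(complex ^ 'n) set \<Rightarrow> (complex ^ 'n \<Rightarrow> complex) \<Rightarrow> bool" where
  "holomorphic_several \<Omega> f \<longleftrightarrow>
     (\<forall>z\<in>\<Omega>. \<exists>f'. (f has_derivative f') (at z) \<and> (\<forall>c v. f' (c *s v) = c * f' v))"

text \<open>Elements of the Lebesgue spaces are represented by functions: two functions that agree
  almost everywhere on the domain stand for the same element, and values off the domain are
  irrelevant.\<close>

definition Lp_space :: "real \<Rightarrow> (complex ^ 'n) set \<Rightarrow> (complex ^ 'n \<Rightarrow> complex) set" where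
  "Lp_space p \<Omega> = {f. f \<in> borel_measurable (lebesgue_on \<Omega>) \<and>
                       integrable (lebesgue_on \<Omega>) (\<lambda>z. norm (f z) powr p)}"

text \<open>This is the norm only on \<open>Lp_space p \<Omega>\<close>; off that space the integral takes the default
  value 0, so membership always has to be stated alongside.\<close>

definition Lp_norm :: "real \<Rightarrow> (complex ^ 'n) set \<Rightarrow> (complex ^ 'n \<Rightarrow> complex) \<Rightarrow> real" where
  "Lp_norm p \<Omega> f = (integral\<^sup>L (lebesgue_on \<Omega>) (\<lambda>z. norm (f z) powr p)) powr (1 / p)"

definition bergman_space :: "real \<Rightarrow> (complex ^ 'n) set \<Rightarrow> (complex ^ 'n \<Rightarrow> complex) set" where
  "bergman_space p \<Omega> = {f \<in> Lp_space p \<Omega>. holomorphic_several \<Omega> f}"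

text \<open>The second conjunct says that \<open>T\<close> acts on classes modulo almost-everywhere equality.
  Holomorphic functions have canonical representatives, so values of \<open>T\<close> are compared at every
  point of the domain.\<close>

definition bounded_linear_L2_A2 ::
  "(complex ^ 'n) set \<Rightarrow> ((complex ^ 'n \<Rightarrow> complex) \<Rightarrow> (complex ^ 'n \<Rightarrow> complex)) \<Rightarrow> bool" where
  "bounded_linear_L2_A2 \<Omega> T \<longleftrightarrow>
     (\<forall>f\<in>Lp_space 2 \<Omega>. T f \<in> bergman_space 2 \<Omega>) \<and>
     (\<forall>f\<in>Lp_space 2 \<Omega>. \<forall>g\<in>Lp_space 2 \<Omega>.
        (AE z in lebesgue_on \<Omega>. f z = g z) \<longrightarrow> (\<forall>z\<in>\<Omega>. T f z = T g z)) \<and>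
     (\<forall>f\<in>Lp_space 2 \<Omega>. \<forall>g\<in>Lp_space 2 \<Omega>. \<forall>z\<in>\<Omega>. T (\<lambda>w. f w + g w) z = T f z + T g z) \<and>
     (\<forall>c. \<forall>f\<in>Lp_space 2 \<Omega>. \<forall>z\<in>\<Omega>. T (\<lambda>w. c * f w) z = c * T f z) \<and>
     (\<exists>B. \<forall>f\<in>Lp_space 2 \<Omega>. Lp_norm 2 \<Omega> (T f) \<le> B * Lp_norm 2 \<Omega> f)"

definition kernel_op ::
  "(complex ^ 'n \<Rightarrow> complex ^ 'n \<Rightarrow> complex) \<Rightarrow> (complex ^ 'n) set \<Rightarrow>
   (complex ^ 'n \<Rightarrow> complex) \<Rightarrow> (complex ^ 'n \<Rightarrow> complex)" where
  "kernel_op P \<Omega> f z = integral\<^sup>L (lebesgue_on \<Omega>) (\<lambda>w. P z w * f w)"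

text \<open>The integral defining \<open>kernel_op P \<Omega> f z\<close> converges absolutely for almost every \<open>z\<close>;
  without this, \<open>kernel_op\<close> would silently return the default value 0.\<close>

definition kernel_converges ::
  "(complex ^ 'n \<Rightarrow> complex ^ 'n \<Rightarrow> complex) \<Rightarrow> (complex ^ 'n) set \<Rightarrow>
   (complex ^ 'n \<Rightarrow> complex) \<Rightarrow> bool" where
  "kernel_converges P \<Omega> f \<longleftrightarrow>
     (AE z in lebesgue_on \<Omega>. integrable (lebesgue_on \<Omega>) (\<lambda>w. P z w * f w))"

end

theory Submission
  imports Defs
begin

text \<open>Truncate \<open>f\<close> where its modulus exceeds \<open>k\<close>. The truncations \<open>g\<^sub>k\<close> lie in
  \<open>L\<^sup>2\<close>, because \<open>\<bar>g\<^sub>k\<bar>\<^sup>2 \<le> k\<^bsup>2-p\<^esup> \<bar>f\<bar>\<^sup>p\<close>, and converge to \<open>f\<close> in \<open>L\<^sup>p\<close> by dominated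
  convergence. The operator reproduces \<open>f\<close>, so its values \<open>F\<^sub>k\<close> at \<open>g\<^sub>k\<close> are elements of \<open>A\<^sup>2\<close>
  with \<open>\<parallel>F\<^sub>k - f\<parallel>\<^sub>p \<le> C \<parallel>g\<^sub>k - f\<parallel>\<^sub>p\<close>.\<close>

text \<open>Large values are replaced by 0 instead of being scaled back to modulus \<open>k\<close>,
  so the difference from \<open>f\<close> is at every point either 0 or \<open>- f z\<close>, and
  \<open>norm (f z)\<close> dominates it.\<close>

definition truncate_at :: "real \<Rightarrow> ('a \<Rightarrow> 'b::real_normed_vector) \<Rightarrow> 'a \<Rightarrow> 'b" where
  "truncate_at k f z = (if norm (f z) \<le> k then f z else 0)"

lemma truncate_at_measurable [measurable]:
  fixes f :: "'a \<Rightarrow> 'b::{real_normed_vector, second_countable_topology}"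
  assumes [measurable]: "f \<in> borel_measurable M"
  shows "truncate_at k f \<in> borel_measurable M"
  unfolding truncate_at_def[abs_def] by measurable

lemma norm_truncate_at_powr_le:
  assumes "0 < p" "p \<le> q" "0 \<le> k"
  shows "norm (truncate_at k f z) powr q \<le> k powr (q - p) * norm (f z) powr p"
proof (cases "norm (f z) \<le> k")
  case True
  \<comment> \<open>Zeros of \<open>f\<close> need no separate case: \<open>0 powr x = 0\<close> for
    every \<open>x\<close>, even \<open>x = 0\<close>.\<close>
  have "norm (f z) powr q = norm (f z) powr (q - p) * norm (f z) powr p"
    by (simp flip: powr_add)
  also have "\<dots> \<le> k powr (q - p) * norm (f z) powr p"
    using assms True by (intro mult_right_mono powr_mono2) auto
  finally show ?thesis
    using True by (simp add: truncate_at_def)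
qed (use assms in \<open>simp add: truncate_at_def\<close>)

lemma truncate_at_in_Lp_space:
  assumes "f \<in> Lp_space p \<Omega>" "0 < p" "p \<le> q" "0 \<le> k"
  shows "truncate_at k f \<in> Lp_space q \<Omega>"
proof -
  have [measurable]: "f \<in> borel_measurable (lebesgue_on \<Omega>)"
    and int: "integrable (lebesgue_on \<Omega>) (\<lambda>z. norm (f z) powr p)"
    using assms(1) by (auto simp: Lp_space_def)
  have "integrable (lebesgue_on \<Omega>) (\<lambda>z. norm (truncate_at k f z) powr q)"
  proof (rule Bochner_Integration.integrable_bound)
    show "integrable (lebesgue_on \<Omega>) (\<lambda>z. k powr (q - p) * norm (f z) powr p)"
      using int by simp
  qed (use norm_truncate_at_powr_le[OF assms(2-4), of f] in auto)
  then show ?thesis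
    by (simp add: Lp_space_def)
qed

lemma truncate_at_diff_in_Lp_space:
  assumes "f \<in> Lp_space p \<Omega>"
  shows "(\<lambda>z. truncate_at k f z - f z) \<in> Lp_space p \<Omega>"
proof -
  have [measurable]: "f \<in> borel_measurable (lebesgue_on \<Omega>)"
    and int: "integrable (lebesgue_on \<Omega>) (\<lambda>z. norm (f z) powr p)"
    using assms by (auto simp: Lp_space_def)
  have "integrable (lebesgue_on \<Omega>) (\<lambda>z. norm (truncate_at k f z - f z) powr p)"
    by (rule Bochner_Integration.integrable_bound[OF int])
      (auto simp: truncate_at_def)
  then show ?thesis
    by (simp add: Lp_space_def)
qed

lemma truncate_at_tendsto_Lp:
  assumes "f \<in> Lp_space p \<Omega>" "0 < p"
  shows "(\<lambda>k. Lp_norm p \<Omega> (\<lambda>z. truncate_at (real k) f z - f z)) \<longlonglongrightarrow> 0"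
proof -
  have [measurable]: "f \<in> borel_measurable (lebesgue_on \<Omega>)"
    and int: "integrable (lebesgue_on \<Omega>) (\<lambda>z. norm (f z) powr p)"
    using assms(1) by (auto simp: Lp_space_def)
  \<comment> \<open>At a fixed \<open>z\<close> the difference is exactly 0 as soon as
    \<open>k\<close> reaches \<open>norm (f z)\<close>, so the convergence holds at every
    point.\<close>
  have ptw: "(\<lambda>k. norm (truncate_at (real k) f z - f z) powr p) \<longlonglongrightarrow> 0" for z
  proof (rule tendsto_eventually)
    obtain N where "norm (f z) \<le> real N"
      using real_arch_simple by blast
    then show "\<forall>\<^sub>F k in sequentially. norm (truncate_at (real k) f z - f z) powr p = 0"
      by (intro eventually_sequentiallyI[of N]) (auto simp: truncate_at_def)
  qed
  have "(\<lambda>k. integral\<^sup>L (lebesgue_on \<Omega>) (\<lambda>z. norm (truncate_at (real k) f z - f z) powr p))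
      \<longlonglongrightarrow> integral\<^sup>L (lebesgue_on \<Omega>) (\<lambda>z. 0)"
    by (rule integral_dominated_convergence[OF _ _ int])
      (use ptw in \<open>auto simp: truncate_at_def\<close>)
  then have "(\<lambda>k. integral\<^sup>L (lebesgue_on \<Omega>) (\<lambda>z. norm (truncate_at (real k) f z - f z) powr p))
      \<longlonglongrightarrow> 0"
    by simp
  then have "(\<lambda>k. Lp_norm p \<Omega> (\<lambda>z. truncate_at (real k) f z - f z)) \<longlonglongrightarrow> 0 powr (1 / p)"
    unfolding Lp_norm_def using assms(2)
    \<comment> \<open>The base tends to 0, where \<open>tendsto_powr\<close> does not apply;
      nonnegative bases and the positive exponent \<open>1 / p\<close> are what make the root
      continuous there.\<close>
    by (intro tendsto_powr2) (auto intro!: always_eventually)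
  then show ?thesis
    by simp
qed

text \<open>The integral formula determines \<open>T\<close> only almost everywhere; this carries
  membership and norm bounds from \<open>kernel_op\<close> over to the values of
  \<open>T\<close>.\<close>

lemma
  assumes "g \<in> Lp_space p \<Omega>" and "h \<in> borel_measurable (lebesgue_on \<Omega>)"
    and "AE z in lebesgue_on \<Omega>. h z = g z"
  shows Lp_space_AE_cong: "h \<in> Lp_space p \<Omega>"
    and Lp_norm_AE_cong: "Lp_norm p \<Omega> h = Lp_norm p \<Omega> g"
proof -
  note [measurable] = assms(2)
  have [measurable]: "g \<in> borel_measurable (lebesgue_on \<Omega>)"
    using assms(1) by (simp add: Lp_space_def)
  have ae: "AE z in lebesgue_on \<Omega>. norm (h z) powr p = norm (g z) powr p"
    using assms(3) by eventually_elim simp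
  have "integrable (lebesgue_on \<Omega>) (\<lambda>z. norm (h z) powr p)
      \<longleftrightarrow> integrable (lebesgue_on \<Omega>) (\<lambda>z. norm (g z) powr p)"
    by (rule integrable_cong_AE[OF _ _ ae]) auto
  then show "h \<in> Lp_space p \<Omega>"
    using assms(1,2) by (simp add: Lp_space_def)
  have "integral\<^sup>L (lebesgue_on \<Omega>) (\<lambda>z. norm (h z) powr p)
      = integral\<^sup>L (lebesgue_on \<Omega>) (\<lambda>z. norm (g z) powr p)"
    by (rule integral_cong_AE[OF _ _ ae]) auto
  then show "Lp_norm p \<Omega> h = Lp_norm p \<Omega> g"
    by (simp add: Lp_norm_def)
qed

text \<open>The integral is additive at those \<open>z\<close> where both integrals converge
  absolutely, which is almost every \<open>z\<close>; elsewhere the default value 0 could break the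
  identity.\<close>

lemma kernel_op_diff:
  assumes "kernel_converges P \<Omega> f" "kernel_converges P \<Omega> g"
  shows "AE z in lebesgue_on \<Omega>.
    kernel_op P \<Omega> (\<lambda>w. f w - g w) z = kernel_op P \<Omega> f z - kernel_op P \<Omega> g z"
  using assms unfolding kernel_converges_def
  by eventually_elim (simp add: kernel_op_def right_diff_distrib)

theorem proposition0p3:
  fixes \<Omega> :: "(complex ^ 'n) set"
    and p :: real
    and T :: "(complex ^ 'n \<Rightarrow> complex) \<Rightarrow> (complex ^ 'n \<Rightarrow> complex)"
    and P :: "complex ^ 'n \<Rightarrow> complex ^ 'n \<Rightarrow> complex"
  assumes "domain_in \<Omega>"
    and "1 < p" and "p < 2"
    and "bounded_linear_L2_A2 \<Omega> T"
    and "\<forall>f\<in>Lp_space 2 \<Omega>. kernel_converges P \<Omega> f \<and>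
           (AE z in lebesgue_on \<Omega>. T f z = kernel_op P \<Omega> f z)"
    and "\<forall>f\<in>Lp_space p \<Omega>. kernel_converges P \<Omega> f"
    and "\<exists>C>0. \<forall>f\<in>Lp_space p \<Omega>. kernel_op P \<Omega> f \<in> Lp_space p \<Omega> \<and>
           Lp_norm p \<Omega> (kernel_op P \<Omega> f) \<le> C * Lp_norm p \<Omega> f"
    and "\<forall>h\<in>bergman_space p \<Omega>. AE z in lebesgue_on \<Omega>. kernel_op P \<Omega> h z = h z"
  shows "\<forall>f\<in>bergman_space p \<Omega>. \<exists>F :: nat \<Rightarrow> complex ^ 'n \<Rightarrow> complex.
           (\<forall>k. F k \<in> bergman_space 2 \<Omega> \<and> (\<lambda>z. F k z - f z) \<in> Lp_space p \<Omega>) \<and>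
           (\<lambda>k. Lp_norm p \<Omega> (\<lambda>z. F k z - f z)) \<longlonglongrightarrow> 0"
proof
  fix f assume f: "f \<in> bergman_space p \<Omega>"
  then have fp: "f \<in> Lp_space p \<Omega>"
    by (simp add: bergman_space_def)
  obtain C where C: "\<And>h. h \<in> Lp_space p \<Omega> \<Longrightarrow> kernel_op P \<Omega> h \<in> Lp_space p \<Omega>"
    "\<And>h. h \<in> Lp_space p \<Omega> \<Longrightarrow> Lp_norm p \<Omega> (kernel_op P \<Omega> h) \<le> C * Lp_norm p \<Omega> h"
    using assms(7) by blast
  define g where "g k = truncate_at (real k) f" for k
  have g2: "g k \<in> Lp_space 2 \<Omega>" for k
    unfolding g_def using assms(2,3) by (intro truncate_at_in_Lp_space[OF fp]) auto
  have gf: "(\<lambda>z. g k z - f z) \<in> Lp_space p \<Omega>" for k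
    unfolding g_def by (rule truncate_at_diff_in_Lp_space[OF fp])
  have F2: "T (g k) \<in> bergman_space 2 \<Omega>" for k
    using assms(4) g2 by (simp add: bounded_linear_L2_A2_def)
  have meas: "(\<lambda>z. T (g k) z - f z) \<in> borel_measurable (lebesgue_on \<Omega>)" for k
    using F2[of k] fp by (auto simp: bergman_space_def Lp_space_def)
  \<comment> \<open>Since \<open>f\<close> may lie outside L^2, the hypotheses say nothing about
    \<open>T f\<close>. The kernel links the two spaces: it represents \<open>T\<close> on
    \<open>g k\<close> and reproduces \<open>f\<close>. Convergence of the two integrals comes from
    the L^2 hypothesis for \<open>g k\<close> and from the L^p hypothesis for
    \<open>f\<close>.\<close>
  have ae: "AE z in lebesgue_on \<Omega>. T (g k) z - f z = kernel_op P \<Omega> (\<lambda>w. g k w - f w) z" for k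
  proof -
    have "AE z in lebesgue_on \<Omega>. T (g k) z = kernel_op P \<Omega> (g k) z"
      using assms(5) g2 by blast
    moreover have "AE z in lebesgue_on \<Omega>. kernel_op P \<Omega> f z = f z"
      using assms(8) f by blast
    moreover have "AE z in lebesgue_on \<Omega>.
        kernel_op P \<Omega> (\<lambda>w. g k w - f w) z = kernel_op P \<Omega> (g k) z - kernel_op P \<Omega> f z"
      using assms(5,6) g2 fp by (intro kernel_op_diff) auto
    ultimately show ?thesis
      by eventually_elim simp
  qed
  \<comment> \<open>Membership gives the norm its meaning: outside the space the integral could
    default to 0.\<close>
  have Fp: "(\<lambda>z. T (g k) z - f z) \<in> Lp_space p \<Omega>" for k
    by (rule Lp_space_AE_cong[OF C(1)[OF gf] meas ae])
  have le: "Lp_norm p \<Omega> (\<lambda>z. T (g k) z - f z) \<le> C * Lp_norm p \<Omega> (\<lambda>z. g k z - f z)" for k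
    using C(2)[OF gf] Lp_norm_AE_cong[OF C(1)[OF gf] meas ae] by simp
  have "(\<lambda>k. C * Lp_norm p \<Omega> (\<lambda>z. g k z - f z)) \<longlonglongrightarrow> 0"
    unfolding g_def using truncate_at_tendsto_Lp[OF fp] assms(2)
    by (intro tendsto_mult_right_zero) auto
  \<comment> \<open>The lower bound of the sandwich is 0, because a value of \<open>powr\<close> is
    never negative.\<close>
  then have "(\<lambda>k. Lp_norm p \<Omega> (\<lambda>z. T (g k) z - f z)) \<longlonglongrightarrow> 0"
    by (rule tendsto_sandwich[OF _ _ tendsto_const, rotated 2])
      (use le in \<open>auto simp: Lp_norm_def\<close>)
  then show "\<exists>F :: nat \<Rightarrow> complex ^ 'n \<Rightarrow> complex.
      (\<forall>k. F k \<in> bergman_space 2 \<Omega> \<and> (\<lambda>z. F k z - f z) \<in> Lp_space p \<Omega>) \<and>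
      (\<lambda>k. Lp_norm p \<Omega> (\<lambda>z. F k z - f z)) \<longlonglongrightarrow> 0"
    using F2 Fp by (intro exI[of _ "\<lambda>k. T (g k)"]) simp
qed

end
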